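(* Let $\phi(x)=a_0x^3+a_1x^2+a_2x+a_3$ with $a_i\in\mathbb{R}$, $a_0>0$, let $\gamma=\{(x,y)\in\mathbb{R}^2: y^2=\phi(x)\}$, and let $w$ be a weight function on $\Omega_\gamma=\{x\in\mathbb{R}:\phi(x)>0\}$. Let $\mathcal{V}_n=\mathcal{V}_n(\gamma,w)$ be the space of orthogonal polynomials of degree $n$ in two variables with respect to $\langle\cdot,\cdot\rangle_{\gamma,w}$. Then, for $n\in\mathbb{N}_0$, $\dim\mathcal{V}_0=1$, $\dim\mathcal{V}_1=2$, and $$\dim\mathcal{V}_n=3,\qquad n\ge 2.$$
   Context: A weight function $w$ on $\Omega_\gamma$ is a nonnegative measurable function, not almost everywhere zero, all of whose moments $\int_{\Omega_\gamma}|x|^k w(x)\,\mathrm{d}x$ are finite; its support may be a proper subset of $\Omega_\gamma$. The bilinear form $$\langle f,g\rangle_{\gamma,w}=\int_{\Omega_\gamma}\Big[f\big(x,\sqrt{\phi(x)}\big)g\big(x,\sqrt{\phi(x)}\big)+f\big(x,-\sqrt{\phi(x)}\big)g\big(x,-\sqrt{\phi(x)}\big)\Big]w(x)\,\mathrm{d}x$$ is an inner product on $\mathbb{R}[x,y]/\langle y^2-\phi(x)\rangle$. Let $\Pi_n(\gamma)$ be the image in $\mathbb{R}[x,y]/\langle y^2-\phi(x)\rangle$ of the polynomials in $x,y$ of total degree at most $n$ (with $\Pi_{-1}(\gamma)=\{0\}$). Then $\mathcal{V}_n(\gamma,w)$ is the space of all $P\in\Pi_n(\gamma)$ with $\langle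 P,Q\rangle_{\gamma,w}=0$ for all $Q\in\Pi_{n-1}(\gamma)$. *)

theory Defs
  imports
    "HOL-Analysis.Analysis"
    "HOL-Algebra.Embedded_Algebras"
    "HOL-Algebra.QuotRing"
    "HOL-Algebra.Algebraic_Closure_Type"
begin

text \<open>
  A polynomial in two variables is an element of \<^typ>\<open>real poly poly\<close>: the inner variable is \<open>x\<close>
  and the outer one is \<open>y\<close>, so the coefficient of \<open>x\<^sup>i y\<^sup>j\<close> in \<open>p\<close> is
  \<open>Polynomial.coeff (Polynomial.coeff p j) i\<close>.
\<close>

abbreviation bipoly_ring :: "real poly poly ring" where
  "bipoly_ring \<equiv> ring_of_type_algebra"

definition eval2 :: "real poly poly \<Rightarrow> real \<Rightarrow> real \<Rightarrow> real" where
  "eval2 p x y = poly (poly p [:y:]) x"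

text \<open>The degree bound is an integer so that the bound \<open>-1\<close> leaves only the zero polynomial.\<close>

definition total_degree_le :: "real poly poly \<Rightarrow> int \<Rightarrow> bool" where
  "total_degree_le p n \<longleftrightarrow>
     (\<forall>i j. Polynomial.coeff (Polynomial.coeff p j) i \<noteq> 0 \<longrightarrow> int i + int j \<le> n)"

definition curve :: "real poly \<Rightarrow> (real \<times> real) set" where
  "curve \<phi> = {(x, y). y\<^sup>2 = poly \<phi> x}"

definition curve_ideal :: "real poly \<Rightarrow> real poly poly set" where
  "curve_ideal \<phi> = PIdl\<^bsub>bipoly_ring\<^esub> (Polynomial.monom 1 2 - [:\<phi>:])"

definition curve_ring :: "real poly \<Rightarrow> real poly poly set ring" where
  "curve_ring \<phi> = bipoly_ring Quot curve_ideal \<phi>"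

definition curve_class :: "real poly \<Rightarrow> real poly poly \<Rightarrow> real poly poly set" where
  "curve_class \<phi> p = curve_ideal \<phi> +>\<^bsub>bipoly_ring\<^esub> p"

text \<open>
  The image of \<open>\<real>\<close> in the quotient ring; multiplying by its elements is the scalar
  multiplication, so dimensions over this subfield are dimensions of real vector spaces.
\<close>

definition scalars :: "real poly \<Rightarrow> real poly poly set set" where
  "scalars \<phi> = range (\<lambda>c. curve_class \<phi> [:[:c:]:])"

definition Pi_space :: "real poly \<Rightarrow> int \<Rightarrow> real poly poly set set" where
  "Pi_space \<phi> n = curve_class \<phi> ` {p. total_degree_le p n}"

text \<open>
  The value of a residue class at a point, meaningful at points of the curve, where all
  representatives agree (see \<open>eval_class_curve_class\<close> below).
\<close>

definition eval_class :: "real poly poly set \<Rightarrow> real \<Rightarrow> real \<Rightarrow> real" where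
  "eval_class F x y = the_elem ((\<lambda>p. eval2 p x y) ` F)"

definition Omega :: "real poly \<Rightarrow> real set" where
  "Omega \<phi> = {x. poly \<phi> x > 0}"

definition weight_on :: "real set \<Rightarrow> (real \<Rightarrow> real) \<Rightarrow> bool" where
  "weight_on S w \<longleftrightarrow>
     w \<in> borel_measurable (lebesgue_on S) \<and>
     (\<forall>x\<in>S. 0 \<le> w x) \<and>
     \<not> (AE x in lebesgue_on S. w x = 0) \<and>
     (\<forall>k::nat. integrable (lebesgue_on S) (\<lambda>x. \<bar>x\<bar> ^ k * w x))"

definition curve_inner ::
  "real poly \<Rightarrow> (real \<Rightarrow> real) \<Rightarrow> real poly poly set \<Rightarrow> real poly poly set \<Rightarrow> real" where
  "curve_inner \<phi> w F G =
     (LINT x | lebesgue_on (Omega \<phi>).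
        (eval_class F x (sqrt (poly \<phi> x)) * eval_class G x (sqrt (poly \<phi> x)) +
         eval_class F x (- sqrt (poly \<phi> x)) * eval_class G x (- sqrt (poly \<phi> x))) * w x)"

definition V_space :: "real poly \<Rightarrow> (real \<Rightarrow> real) \<Rightarrow> nat \<Rightarrow> real poly poly set set" where
  "V_space \<phi> w n =
     {P \<in> Pi_space \<phi> (int n). \<forall>Q \<in> Pi_space \<phi> (int n - 1). curve_inner \<phi> w P Q = 0}"

lemma bipoly_ring_sel [simp]:
  "carrier bipoly_ring = UNIV" "p \<otimes>\<^bsub>bipoly_ring\<^esub> q = p * q" "p \<oplus>\<^bsub>bipoly_ring\<^esub> q = p + q"
  "\<one>\<^bsub>bipoly_ring\<^esub> = 1" "\<zero>\<^bsub>bipoly_ring\<^esub> = 0"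
  by (simp_all add: ring_of_type_algebra_def)

lemma curve_class_eq:
  "curve_class \<phi> p = {r * (Polynomial.monom 1 2 - [:\<phi>:]) + p | r. True}"
  by (auto simp: curve_class_def curve_ideal_def cgenideal_def a_r_coset_def')

lemma ideal_curve_ideal: "ideal (curve_ideal \<phi>) bipoly_ring"
  unfolding curve_ideal_def
  by (rule cring.cgenideal_ideal[OF cring_from_type_algebra]) simp

lemma ring_curve_ring: "ring (curve_ring \<phi>)"
  unfolding curve_ring_def by (rule ideal.quotient_is_ring[OF ideal_curve_ideal])

lemma eval_class_curve_class:
  assumes "(x, y) \<in> curve \<phi>"
  shows "eval_class (curve_class \<phi> p) x y = eval2 p x y"
proof -
  have "eval2 (r * (Polynomial.monom 1 2 - [:\<phi>:]) + p) x y = eval2 p x y" for r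
    using assms by (simp add: eval2_def curve_def poly_monom)
  then have "(\<lambda>q. eval2 q x y) ` curve_class \<phi> p = {eval2 p x y}"
    by (auto simp: curve_class_eq image_iff)
  then show ?thesis by (simp add: eval_class_def)
qed

lemma curve_class_eq_0_iff:
  "curve_class \<phi> p = curve_class \<phi> 0 \<longleftrightarrow> (Polynomial.monom 1 2 - [:\<phi>:]) dvd p"
proof
  assume "curve_class \<phi> p = curve_class \<phi> 0"
  moreover have "p \<in> curve_class \<phi> p" by (auto simp: curve_class_eq intro: exI[of _ 0])
  ultimately show "(Polynomial.monom 1 2 - [:\<phi>:]) dvd p" by (auto simp: curve_class_eq)
next
  assume "(Polynomial.monom 1 2 - [:\<phi>:]) dvd p"
  then obtain s where s: "p = (Polynomial.monom 1 2 - [:\<phi>:]) * s" by blast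
  have "r * (Polynomial.monom 1 2 - [:\<phi>:]) + p = (r + s) * (Polynomial.monom 1 2 - [:\<phi>:])"
    "r * (Polynomial.monom 1 2 - [:\<phi>:]) = (r - s) * (Polynomial.monom 1 2 - [:\<phi>:]) + p" for r
    unfolding s by (simp_all only: algebra_simps diff_add_cancel)
  then show "curve_class \<phi> p = curve_class \<phi> 0"
    unfolding curve_class_eq by (metis (no_types, opaque_lifting) add.right_neutral)
qed

lemma subfield_scalars: "subfield (scalars \<phi>) (curve_ring \<phi>)"
proof -
  interpret I: ideal "curve_ideal \<phi>" bipoly_ring by (rule ideal_curve_ideal)
  let ?R = "ring_of_type_algebra :: real ring"
  let ?h = "\<lambda>c::real. curve_class \<phi> [:[:c:]:]"
  have R: "field ?R" by (rule field_from_type_algebra)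
  interpret F: field ?R by (rule R)
  have R_sel: "carrier ?R = UNIV" "a \<otimes>\<^bsub>?R\<^esub> b = a * b" "a \<oplus>\<^bsub>?R\<^esub> b = a + b"
    "\<one>\<^bsub>?R\<^esub> = 1" "\<zero>\<^bsub>?R\<^esub> = 0" for a b by (simp_all add: ring_of_type_algebra_def)
  have cls: "curve_class \<phi> \<in> ring_hom bipoly_ring (curve_ring \<phi>)"
    using I.rcos_ring_hom unfolding curve_class_def curve_ring_def by simp
  have "(\<lambda>c. [:[:c:]:]) \<in> ring_hom ?R bipoly_ring"
    by (rule ring_hom_memI) (simp_all add: R_sel one_pCons)
  then have "?h \<in> ring_hom ?R (curve_ring \<phi>)"
    using ring_hom_trans[OF _ cls] by (force simp: comp_def)
  then interpret h: ring_hom_ring ?R "curve_ring \<phi>" ?h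
    by (intro ring_hom_ringI2 ring_curve_ring F.ring_axioms)
  have "\<one>\<^bsub>curve_ring \<phi>\<^esub> \<noteq> \<zero>\<^bsub>curve_ring \<phi>\<^esub>"
  proof
    assume "\<one>\<^bsub>curve_ring \<phi>\<^esub> = \<zero>\<^bsub>curve_ring \<phi>\<^esub>"
    then have "curve_class \<phi> [:[:1:]:] = curve_class \<phi> 0"
      using h.hom_one h.hom_zero by (simp add: R_sel)
    then have "(Polynomial.monom 1 2 - [:\<phi>:]) dvd 1"
      by (simp add: curve_class_eq_0_iff flip: one_pCons)
    moreover have "Polynomial.degree (Polynomial.monom 1 2 - [:\<phi>:]) = 2"
      by (simp add: numeral_2_eq_2 Polynomial.monom_Suc)
    ultimately show False by (auto dest: dvd_imp_degree_le)
  qed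
  then show ?thesis
    using h.img_is_subfield(2)[OF F.carrier_is_subfield] by (simp add: R_sel scalars_def)
qed

end

theory Submission
  imports Defs
begin

text \<open>
  Modulo \<open>y\<^sup>2 - \<phi>\<close> every polynomial has a unique normal form \<open>A(x) + y B(x)\<close>, and giving \<open>x\<close>
  weight 2 and \<open>y\<close> weight 3 (the orders of their poles at infinity) identifies the image of the
  polynomials of total degree at most \<open>n\<close> with the normal forms of weight at most \<open>3n\<close>. The inner
  product decouples the even and odd parts:
  \<open>\<langle>A + yB, C + yD\<rangle> = 2\<integral>ACw + 2\<integral>BD\<phi>w\<close>. So the orthogonal polynomials of degree \<open>n\<close> are spanned
  by the univariate orthogonal polynomials for \<open>w\<close>, and \<open>y\<close> times those for \<open>\<phi>w\<close>, with degrees in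
  consecutive ranges, and the lengths of the two ranges add up by telescoping.
\<close>

section \<open>Univariate orthogonal polynomials\<close>

text \<open>The strict bound makes \<open>N\<close> the dimension of the space it cuts out;
  \<open>N = 0\<close> leaves only the zero polynomial.\<close>

definition deg_lt :: "nat \<Rightarrow> real poly \<Rightarrow> bool" where
  "deg_lt N A \<longleftrightarrow> (\<forall>i\<ge>N. Polynomial.coeff A i = 0)"

lemma deg_lt_0 [simp]: "deg_lt N 0" "deg_lt 0 A \<longleftrightarrow> A = 0"
  by (auto simp: deg_lt_def poly_eq_iff)

lemma deg_lt_add: "deg_lt N A \<Longrightarrow> deg_lt N B \<Longrightarrow> deg_lt N (A + B)"
  and deg_lt_diff: "deg_lt N A \<Longrightarrow> deg_lt N B \<Longrightarrow> deg_lt N (A - B)"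
  and deg_lt_smult: "deg_lt N A \<Longrightarrow> deg_lt N (Polynomial.smult c A)"
  and deg_lt_mono: "deg_lt M A \<Longrightarrow> M \<le> N \<Longrightarrow> deg_lt N A"
  by (simp_all add: deg_lt_def)

text \<open>For positive \<open>L\<close> and \<open>M \<le> N\<close>, this is the orthogonal
  complement of degrees below \<open>M\<close> inside degrees below \<open>N\<close>, of dimension
  \<open>N - M\<close>.\<close>

definition orth :: "(real poly \<Rightarrow> real) \<Rightarrow> nat \<Rightarrow> nat \<Rightarrow> real poly set" where
  "orth L N M = {A. deg_lt N A \<and> (\<forall>C. deg_lt M C \<longrightarrow> L (A * C) = 0)}"

locale positive_functional =
  fixes L :: "real poly \<Rightarrow> real"
  assumes add: "L (A + B) = L A + L B"
    and smult: "L (Polynomial.smult c A) = c * L A"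
    and pos: "A \<noteq> 0 \<Longrightarrow> L (A * A) > 0"
begin

lemma zero: "L 0 = 0"
  using smult[of 0 0] by simp

lemma diff: "L (A - B) = L A - L B"
  using add[of "A - B" B] by simp

lemma zero_in_orth: "0 \<in> orth L N M"
  by (simp add: orth_def zero)

lemma add_in_orth: "A \<in> orth L N M \<Longrightarrow> B \<in> orth L N M \<Longrightarrow> A + B \<in> orth L N M"
  by (simp add: orth_def deg_lt_add add distrib_right)

lemma diff_in_orth: "A \<in> orth L N M \<Longrightarrow> B \<in> orth L N M \<Longrightarrow> A - B \<in> orth L N M"
  by (simp add: orth_def deg_lt_diff diff left_diff_distrib)

lemma smult_in_orth: "A \<in> orth L N M \<Longrightarrow> Polynomial.smult c A \<in> orth L N M"
  by (simp add: orth_def deg_lt_smult smult)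

lemma orth_mono: "N \<le> N' \<Longrightarrow> M' \<le> M \<Longrightarrow> orth L N M \<subseteq> orth L N' M'"
  by (auto simp: orth_def intro: deg_lt_mono)

lemma orth_same: "orth L N N = {0}"
proof -
  have "A = 0" if "A \<in> orth L N N" for A
    using that pos[of A] by (auto simp: orth_def)
  then show ?thesis using zero_in_orth by blast
qed

text \<open>Gram-Schmidt: the projection for \<open>Suc N\<close> adds to the one for
  \<open>N\<close> the component along the monic orthogonal polynomial of degree \<open>N\<close>.
  Positivity lets one divide by its squared norm.\<close>

lemma projection_exists: "\<exists>q. deg_lt N q \<and> (\<forall>C. deg_lt N C \<longrightarrow> L ((f - q) * C) = 0)"
proof (induction N arbitrary: f)
  case 0
  then show ?case by (simp add: zero)
next
  case (Suc N)
  obtain q where q: "deg_lt N q" "\<And>C. deg_lt N C \<Longrightarrow> L ((f - q) * C) = 0"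
    using Suc.IH by blast
  obtain r where r: "deg_lt N r" "\<And>C. deg_lt N C \<Longrightarrow> L ((Polynomial.monom 1 N - r) * C) = 0"
    using Suc.IH by blast
  define p where "p = Polynomial.monom 1 N - r"
  have pN: "Polynomial.coeff p N = 1" "deg_lt (Suc N) p"
    using r(1) by (auto simp: p_def deg_lt_def)
  then have "p \<noteq> 0" by auto
  then have pp: "L (p * p) > 0" by (rule pos)
  define c where "c = L ((f - q) * p) / L (p * p)"
  have "L ((f - (q + Polynomial.smult c p)) * C) = 0" if C: "deg_lt (Suc N) C" for C
  proof -
    define d where "d = Polynomial.coeff C N"
    \<comment> \<open>Subtracting \<open>d\<close> times the monic \<open>p\<close> cancels the
      coefficient of \<open>x^N\<close>, so \<open>C'\<close> is a test polynomial for the bound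
      \<open>N\<close>.\<close>
    define C' where "C' = C - Polynomial.smult d p"
    have C': "deg_lt N C'"
      unfolding deg_lt_def
    proof (intro allI impI)
      fix i assume "N \<le> i"
      then consider "i = N" | "Suc N \<le> i" by linarith
      then show "Polynomial.coeff C' i = 0"
        using C pN by cases (auto simp: C'_def d_def deg_lt_def)
    qed
    \<comment> \<open>Expanding \<open>C = C' + d p\<close>: the first term vanishes by the choice
      of \<open>q\<close>, the second by orthogonality of \<open>p\<close>, the last by the choice
      of \<open>c\<close>.\<close>
    have "(f - (q + Polynomial.smult c p)) * C = (f - q) * C' - Polynomial.smult c (p * C')
        + Polynomial.smult d ((f - q) * p - Polynomial.smult c (p * p))"
      by (simp add: C'_def algebra_simps smult_diff_right smult_add_right)
    moreover have "L (p * C') = 0" using r(2)[OF C'] by (simp add: p_def)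
    moreover have "L ((f - q) * p) = c * L (p * p)" using pp by (simp add: c_def)
    ultimately show ?thesis using q(2)[OF C'] by (simp add: add diff smult)
  qed
  moreover have "deg_lt (Suc N) (q + Polynomial.smult c p)"
    using q(1) pN(2) by (auto intro!: deg_lt_add deg_lt_smult intro: deg_lt_mono)
  ultimately show ?case by blast
qed

text \<open>The monic orthogonal polynomial of degree \<open>N\<close> spans the one new direction:
  subtracting its multiple by the coefficient of \<open>x^N\<close> lowers the degree bound. This is
  the shape that \<open>line_extension\<close> needs.\<close>

lemma orth_Suc:
  assumes "M \<le> N"
  obtains p where "p \<in> orth L (Suc N) M" "p \<notin> orth L N M"
    "\<And>A. A \<in> orth L (Suc N) M \<Longrightarrow> \<exists>c. A - Polynomial.smult c p \<in> orth L N M"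
proof -
  obtain r where r: "deg_lt N r" "\<And>C. deg_lt N C \<Longrightarrow> L ((Polynomial.monom 1 N - r) * C) = 0"
    using projection_exists by blast
  define p where "p = Polynomial.monom 1 N - r"
  have pN: "Polynomial.coeff p N = 1" "deg_lt (Suc N) p"
    using r(1) by (auto simp: p_def deg_lt_def)
  have p: "p \<in> orth L (Suc N) M"
    using pN(2) r(2) deg_lt_mono[OF _ assms] by (simp add: orth_def p_def)
  have "p \<notin> orth L N M"
    using pN(1) by (auto simp: orth_def deg_lt_def)
  moreover have "A - Polynomial.smult (Polynomial.coeff A N) p \<in> orth L N M"
    if "A \<in> orth L (Suc N) M" for A
  proof -
    have *: "A - Polynomial.smult (Polynomial.coeff A N) p \<in> orth L (Suc N) M"
      using that p by (intro diff_in_orth smult_in_orth)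
    have "deg_lt N (A - Polynomial.smult (Polynomial.coeff A N) p)"
      unfolding deg_lt_def
    proof (intro allI impI)
      fix i assume "N \<le> i"
      then consider "i = N" | "Suc N \<le> i" by linarith
      then show "Polynomial.coeff (A - Polynomial.smult (Polynomial.coeff A N) p) i = 0"
        using * pN by cases (auto simp: orth_def deg_lt_def)
    qed
    then show ?thesis using * by (simp add: orth_def)
  qed
  ultimately show thesis using that p by blast
qed

end

section \<open>Normal forms in the coordinate ring\<close>

abbreviation curve_poly :: "real poly \<Rightarrow> real poly poly" where
  "curve_poly \<phi> \<equiv> Polynomial.monom 1 2 - [:\<phi>:]"

lemma curve_poly_eq: "curve_poly \<phi> = [:-\<phi>, 0, 1:]"
  by (simp add: numeral_2_eq_2 Polynomial.monom_Suc monom_0)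

lemma curve_class_hom: "curve_class \<phi> \<in> ring_hom bipoly_ring (curve_ring \<phi>)"
  using ideal.rcos_ring_hom[OF ideal_curve_ideal] unfolding curve_class_def curve_ring_def by simp

lemma curve_class_add: "curve_class \<phi> p \<oplus>\<^bsub>curve_ring \<phi>\<^esub> curve_class \<phi> q = curve_class \<phi> (p + q)"
  and curve_class_mult: "curve_class \<phi> p \<otimes>\<^bsub>curve_ring \<phi>\<^esub> curve_class \<phi> q = curve_class \<phi> (p * q)"
  and curve_class_closed: "curve_class \<phi> p \<in> carrier (curve_ring \<phi>)"
  using ring_hom_add[OF curve_class_hom] ring_hom_mult[OF curve_class_hom]
    ring_hom_closed[OF curve_class_hom] by simp_all

lemma curve_class_zero: "\<zero>\<^bsub>curve_ring \<phi>\<^esub> = curve_class \<phi> 0"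
proof -
  interpret ring "curve_ring \<phi>" by (rule ring_curve_ring)
  show ?thesis
    using curve_class_add[of \<phi> 0 0] curve_class_closed[of \<phi> 0] by (simp add: add.l_cancel_one)
qed

lemma curve_class_eq_iff: "curve_class \<phi> p = curve_class \<phi> q \<longleftrightarrow> curve_poly \<phi> dvd p - q"
proof
  assume "curve_class \<phi> p = curve_class \<phi> q"
  moreover have "p \<in> curve_class \<phi> p" by (auto simp: curve_class_eq intro: exI[of _ 0])
  ultimately show "curve_poly \<phi> dvd p - q" by (auto simp: curve_class_eq)
next
  assume "curve_poly \<phi> dvd p - q"
  then have "curve_class \<phi> (p - q) = curve_class \<phi> 0" by (simp only: curve_class_eq_0_iff)
  then show "curve_class \<phi> p = curve_class \<phi> q"
    using curve_class_add[of \<phi> "p - q" q] curve_class_add[of \<phi> 0 q] by simp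
qed

text \<open>A difference of normal forms has degree at most 1 in \<open>y\<close>, so only 0 can be
  a multiple of \<open>y^2 - \<phi>\<close>.\<close>

lemma normal_form_unique:
  assumes "curve_class \<phi> [:A, B:] = curve_class \<phi> [:C, D:]"
  shows "A = C \<and> B = D"
proof -
  have "curve_poly \<phi> dvd [:A - C, B - D:]"
    using assms by (simp add: curve_class_eq_iff)
  moreover have "Polynomial.degree (curve_poly \<phi>) = 2"
    by (simp add: curve_poly_eq)
  moreover have "Polynomial.degree [:A - C, B - D:] \<le> 1"
    by simp
  ultimately have "[:A - C, B - D:] = 0"
    using dvd_imp_degree_le[of "curve_poly \<phi>" "[:A - C, B - D:]"] by linarith
  then show ?thesis by (simp add: pCons_eq_0_iff)
qed

text \<open>This bounds the pole order at infinity of a polynomial in \<open>x\<close>. The bound is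
  an integer because 3n - 3 and 3n - 6 can be negative, and then only 0 satisfies it.\<close>

definition deg2_le :: "real poly \<Rightarrow> int \<Rightarrow> bool" where
  "deg2_le A m \<longleftrightarrow> A = 0 \<or> 2 * int (Polynomial.degree A) \<le> m"

lemma deg2_le_0 [simp]: "deg2_le 0 m"
  by (simp add: deg2_le_def)

text \<open>Since \<open>div\<close> rounds down, \<open>m div 2 + 1\<close> counts the exponents
  \<open>i\<close> with \<open>2 i \<le> m\<close> when \<open>m\<close> is nonnegative; for
  negative \<open>m\<close> it is at most 0 and \<open>nat\<close> truncates it to 0.\<close>

lemma deg2_le_iff_deg_lt: "deg2_le A m \<longleftrightarrow> deg_lt (nat (m div 2 + 1)) A"
proof (cases "A = 0")
  case False
  have "deg_lt N A \<longleftrightarrow> Polynomial.degree A < N" for N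
  proof
    assume "deg_lt N A"
    then show "Polynomial.degree A < N"
      using False unfolding deg_lt_def by (meson leading_coeff_neq_0 not_le_imp_less)
  next
    assume "Polynomial.degree A < N"
    then show "deg_lt N A" by (simp add: deg_lt_def coeff_eq_0)
  qed
  moreover have "2 * int d \<le> m \<longleftrightarrow> d < nat (m div 2 + 1)" for d
    by linarith
  ultimately show ?thesis using False by (simp only: deg2_le_def simp_thms)
qed simp

lemma deg2_le_add: "deg2_le A m \<Longrightarrow> deg2_le B m \<Longrightarrow> deg2_le (A + B) m"
  by (simp add: deg2_le_iff_deg_lt deg_lt_add)

lemma deg2_le_mult: "deg2_le A m \<Longrightarrow> deg2_le B k \<Longrightarrow> deg2_le (A * B) (m + k)"
  by (cases "A = 0"; cases "B = 0") (auto simp: deg2_le_def Polynomial.degree_mult_eq)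

lemma total_degree_le_pCons:
  "total_degree_le (pCons a q) n \<longleftrightarrow>
    (\<forall>i. Polynomial.coeff a i \<noteq> 0 \<longrightarrow> int i \<le> n) \<and> total_degree_le q (n - 1)"
proof -
  have split: "(\<forall>j. P j) \<longleftrightarrow> P 0 \<and> (\<forall>j. P (Suc j))" for P :: "nat \<Rightarrow> bool"
    by (metis not0_implies_Suc)
  have "total_degree_le (pCons a q) n \<longleftrightarrow>
      (\<forall>j i. Polynomial.coeff (Polynomial.coeff (pCons a q) j) i \<noteq> 0 \<longrightarrow> int i + int j \<le> n)"
    by (auto simp: total_degree_le_def)
  also have "\<dots> \<longleftrightarrow> (\<forall>i. Polynomial.coeff a i \<noteq> 0 \<longrightarrow> int i \<le> n) \<and>
      (\<forall>j i. Polynomial.coeff (Polynomial.coeff q j) i \<noteq> 0 \<longrightarrow> int i + int (Suc j) \<le> n)"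
    by (subst split) simp
  also have "(\<forall>j i. Polynomial.coeff (Polynomial.coeff q j) i \<noteq> 0 \<longrightarrow> int i + int (Suc j) \<le> n)
      \<longleftrightarrow> total_degree_le q (n - 1)"
    unfolding total_degree_le_def by (subst all_comm) (simp add: le_diff_eq algebra_simps)
  finally show ?thesis .
qed

lemma total_degree_le_0 [simp]: "total_degree_le 0 n"
  by (simp add: total_degree_le_def)

lemma total_degree_le_add:
  assumes "total_degree_le p n" "total_degree_le q n"
  shows "total_degree_le (p + q) n"
  using assms unfolding total_degree_le_def coeff_add by (metis add.right_neutral)

text \<open>Horner recursion in \<open>y\<close>: if \<open>q\<close> reduces to
  \<open>C + y D\<close>, then \<open>a + y q\<close> reduces to
  \<open>(a + \<phi> D) + y C\<close>. Here \<open>D\<close> has weight at most 3n - 6 and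
  \<open>\<phi>\<close> at most 6, so the even part stays within 3n.\<close>

lemma normal_form_exists:
  assumes "deg2_le \<phi> 6" "total_degree_le p n"
  shows "\<exists>A B. deg2_le A (3 * n) \<and> deg2_le B (3 * n - 3) \<and> curve_poly \<phi> dvd p - [:A, B:]"
  using assms(2)
proof (induction p arbitrary: n rule: pCons_induct)
  case 0
  then show ?case by (intro exI[of _ 0]) simp
next
  case (pCons a q)
  then have a: "\<And>i. Polynomial.coeff a i \<noteq> 0 \<Longrightarrow> int i \<le> n" and "total_degree_le q (n - 1)"
    by (auto simp: total_degree_le_pCons)
  then obtain C D where CD: "deg2_le C (3 * (n - 1))" "deg2_le D (3 * (n - 1) - 3)"
    "curve_poly \<phi> dvd q - [:C, D:]"
    using pCons.IH by blast
  have "deg2_le a (3 * n)"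
    using a[of "Polynomial.degree a"] by (cases "a = 0") (auto simp: deg2_le_def)
  then have "deg2_le (a + \<phi> * D) (3 * n)"
    using deg2_le_mult[OF assms(1) CD(2)] by (simp add: deg2_le_add)
  moreover have eq: "pCons a q - [:a + \<phi> * D, C:] = [:0, 1:] * (q - [:C, D:]) + [:D:] * curve_poly \<phi>"
    by (simp add: curve_poly_eq)
  have "curve_poly \<phi> dvd pCons a q - [:a + \<phi> * D, C:]"
    unfolding eq by (intro dvd_add dvd_mult CD(3) dvd_refl)
  ultimately show ?case using CD(1) by (intro exI[of _ "a + \<phi> * D"] exI[of _ C]) simp
qed

text \<open>The degree of \<open>A\<close> may exceed \<open>n\<close>, but each factor
  \<open>\<phi>\<close> can be traded for \<open>y^2\<close>, which lowers total degree by one.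
  Writing \<open>A = \<phi> q + r\<close>, the recursion treats \<open>q\<close> with
  \<open>n - 2\<close>: its degree is 3 less, so its weight is 6 less.\<close>

lemma even_part_attained:
  assumes "Polynomial.degree \<phi> = 3" "deg2_le A (3 * n)"
  shows "\<exists>p. total_degree_le p n \<and> curve_poly \<phi> dvd p - [:A:]"
  using assms(2)
proof (induction "Polynomial.degree A" arbitrary: A n rule: less_induct)
  case less
  have small: "total_degree_le [:r:] n"
    if "r = 0 \<or> int (Polynomial.degree r) \<le> n" for r
    using that by (force simp: total_degree_le_pCons dest: le_degree)
  show ?case
  proof (cases "Polynomial.degree A < 3")
    \<comment> \<open>For degrees 0, 1, 2 the bound \<open>2 deg A \<le> 3n\<close> already forces
      \<open>deg A \<le> n\<close>; this first fails at degree 3 with \<open>n = 2\<close>.\<close>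
    case True
    then have "A = 0 \<or> int (Polynomial.degree A) \<le> n"
      using less.prems unfolding deg2_le_def by linarith
    then show ?thesis using small by (intro exI[of _ "[:A:]"]) simp
  next
    case False
    define q r where "q = A div \<phi>" and "r = A mod \<phi>"
    have A: "A = \<phi> * q + r" by (simp add: q_def r_def)
    have "\<phi> \<noteq> 0" using assms(1) by auto
    have r: "Polynomial.degree r < 3"
      using degree_mod_less[OF \<open>\<phi> \<noteq> 0\<close>, of A] assms(1) by (auto simp: r_def)
    then have "q \<noteq> 0" using A False by auto
    then have "Polynomial.degree (\<phi> * q) = Polynomial.degree q + 3"
      using \<open>\<phi> \<noteq> 0\<close> assms(1) by (simp add: Polynomial.degree_mult_eq)
    then have deg_q: "Polynomial.degree q = Polynomial.degree A - 3"
      using r unfolding A by (subst degree_add_eq_left) simp_all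
    have n: "2 * int (Polynomial.degree A) \<le> 3 * n"
      using less.prems False by (auto simp: deg2_le_def)
    have "deg2_le q (3 * (n - 2))"
      using n False by (simp add: deg2_le_def deg_q)
    then obtain p where p: "total_degree_le p (n - 2)" "curve_poly \<phi> dvd p - [:q:]"
      using less.hyps[of q "n - 2"] deg_q False by auto
    have "total_degree_le (pCons 0 (pCons 0 p)) n"
      using p(1) by (simp add: total_degree_le_pCons)
    \<comment> \<open>Here \<open>deg A \<ge> 3\<close> gives \<open>n \<ge> 2\<close>, while
      \<open>r\<close> has degree at most 2.\<close>
    moreover have "total_degree_le [:r:] n"
      using r n False by (intro small) linarith
    ultimately have "total_degree_le (pCons 0 (pCons 0 p) + [:r:]) n"
      by (rule total_degree_le_add)
    moreover have eq: "pCons 0 (pCons 0 p) + [:r:] - [:A:]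
        = [:0, 0, 1:] * (p - [:q:]) + [:q:] * curve_poly \<phi>"
      by (simp add: curve_poly_eq A)
    have "curve_poly \<phi> dvd pCons 0 (pCons 0 p) + [:r:] - [:A:]"
      unfolding eq by (intro dvd_add dvd_mult p(2) dvd_refl)
    ultimately show ?thesis by blast
  qed
qed

text \<open>The two preceding lemmas give the two inclusions; the odd coefficient \<open>B\<close>
  is attained in total degree \<open>n - 1\<close>, as 3n - 3 = 3(n - 1), and \<open>y\<close> costs
  the remaining degree.\<close>

lemma Pi_space_eq:
  assumes "Polynomial.degree \<phi> = 3"
  shows "Pi_space \<phi> n = {curve_class \<phi> [:A, B:] | A B. deg2_le A (3 * n) \<and> deg2_le B (3 * n - 3)}"
proof (intro equalityI subsetI)
  fix F assume "F \<in> Pi_space \<phi> n"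
  then obtain p where p: "total_degree_le p n" "F = curve_class \<phi> p"
    by (auto simp: Pi_space_def)
  have "deg2_le \<phi> 6" using assms by (simp add: deg2_le_def)
  from normal_form_exists[OF this p(1)]
  show "F \<in> {curve_class \<phi> [:A, B:] | A B. deg2_le A (3 * n) \<and> deg2_le B (3 * n - 3)}"
    unfolding p(2) curve_class_eq_iff[symmetric] by blast
next
  fix F assume "F \<in> {curve_class \<phi> [:A, B:] | A B. deg2_le A (3 * n) \<and> deg2_le B (3 * n - 3)}"
  then obtain A B where F: "F = curve_class \<phi> [:A, B:]"
    and A: "deg2_le A (3 * n)" and B: "deg2_le B (3 * (n - 1))"
    by auto
  obtain p where p: "total_degree_le p n" "curve_poly \<phi> dvd p - [:A:]"
    using even_part_attained[OF assms A] by blast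
  obtain q where q: "total_degree_le q (n - 1)" "curve_poly \<phi> dvd q - [:B:]"
    using even_part_attained[OF assms B] by blast
  have "total_degree_le (p + pCons 0 q) n"
    using p(1) q(1) by (intro total_degree_le_add) (simp_all add: total_degree_le_pCons)
  moreover have eq: "p + pCons 0 q - [:A, B:] = (p - [:A:]) + [:0, 1:] * (q - [:B:])"
    by (simp add: algebra_simps)
  have "curve_poly \<phi> dvd p + pCons 0 q - [:A, B:]"
    unfolding eq by (intro dvd_add dvd_mult p(2) q(2))
  ultimately show "F \<in> Pi_space \<phi> n"
    unfolding F Pi_space_def curve_class_eq_iff[symmetric] by (metis image_eqI mem_Collect_eq)
qed

section \<open>Dimension of the space of orthogonal normal forms\<close>

definition orth_classes ::
  "real poly \<Rightarrow> (real poly \<Rightarrow> real) \<Rightarrow> (real poly \<Rightarrow> real) \<Rightarrow> nat \<Rightarrow> nat \<Rightarrow> nat \<Rightarrow> nat \<Rightarrow> real poly poly set set"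
  where "orth_classes \<phi> L L' N M N' M' =
    {curve_class \<phi> [:A, B:] | A B. A \<in> orth L N M \<and> B \<in> orth L' N' M'}"

lemma in_line_extension_iff:
  "F \<in> ring.line_extension (curve_ring \<phi>) (scalars \<phi>) (curve_class \<phi> p) E \<longleftrightarrow>
    (\<exists>c. \<exists>G\<in>E. F = curve_class \<phi> (Polynomial.smult [:c:] p) \<oplus>\<^bsub>curve_ring \<phi>\<^esub> G)"
  by (simp add: ring.line_extension_mem_iff[OF ring_curve_ring] scalars_def curve_class_mult)

text \<open>Starting from the zero space at \<open>N = M\<close>, \<open>N' = M'\<close>, the even
  bound and then the odd bound are raised one at a time. Each step adjoins one orthogonal
  polynomial, whose class is new by uniqueness of normal forms.\<close>

lemma dimension_orth_classes:
  assumes "positive_functional L" "positive_functional L'" "M \<le> N" "M' \<le> N'"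
  shows "ring.dimension (curve_ring \<phi>) ((N - M) + (N' - M')) (scalars \<phi>) (orth_classes \<phi> L L' N M N' M')"
proof -
  interpret L: positive_functional L by (rule assms)
  interpret L': positive_functional L' by (rule assms)
  interpret R: ring "curve_ring \<phi>" by (rule ring_curve_ring)
  have even: "R.dimension (N - M) (scalars \<phi>) (orth_classes \<phi> L L' N M M' M')"
    using \<open>M \<le> N\<close>
  proof (induction N rule: dec_induct)
    case base
    show ?case
      using R.zero_dim by (simp add: orth_classes_def L.orth_same L'.orth_same curve_class_zero)
  next
    case (step N)
    obtain p where p: "p \<in> orth L (Suc N) M" "p \<notin> orth L N M"
      "\<And>A. A \<in> orth L (Suc N) M \<Longrightarrow> \<exists>c. A - Polynomial.smult c p \<in> orth L N M"
      using L.orth_Suc[OF step.hyps(1)] by blast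
    have new: "curve_class \<phi> [:p, 0:] \<notin> orth_classes \<phi> L L' N M M' M'"
      using p(2) by (auto simp: orth_classes_def simp del: pCons_0_0 dest!: normal_form_unique)
    have "R.line_extension (scalars \<phi>) (curve_class \<phi> [:p, 0:]) (orth_classes \<phi> L L' N M M' M')
        = orth_classes \<phi> L L' (Suc N) M M' M'" (is "?E = ?F")
    proof (intro equalityI subsetI)
      fix F assume "F \<in> ?E"
      then obtain c A B where "A \<in> orth L N M" "B \<in> orth L' M' M'"
        "F = curve_class \<phi> [:Polynomial.smult c p + A, B:]"
        by (auto simp: in_line_extension_iff orth_classes_def curve_class_add)
      then show "F \<in> ?F"
        using p(1) L.orth_mono[of N "Suc N" M M]
        by (auto simp: orth_classes_def intro!: L.add_in_orth L.smult_in_orth exI)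
    next
      fix F assume "F \<in> ?F"
      then obtain A B where F: "A \<in> orth L (Suc N) M" "B \<in> orth L' M' M'" "F = curve_class \<phi> [:A, B:]"
        by (auto simp: orth_classes_def)
      obtain c where "A - Polynomial.smult c p \<in> orth L N M" using p(3)[OF F(1)] by blast
      then have "curve_class \<phi> [:A - Polynomial.smult c p, B:] \<in> orth_classes \<phi> L L' N M M' M'"
        using F(2) by (auto simp: orth_classes_def)
      then show "F \<in> ?E"
        unfolding in_line_extension_iff
        by (intro exI[of _ c] bexI) (simp_all add: F(3) curve_class_add)
    qed
    then show ?case
      using R.Suc_dim[OF curve_class_closed new step.IH] step.hyps(1) by (simp add: Suc_diff_le)
  qed
  show ?thesis
    using \<open>M' \<le> N'\<close>
  proof (induction N' rule: dec_induct)
    case base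
    show ?case using even by simp
  next
    case (step N')
    obtain p where p: "p \<in> orth L' (Suc N') M'" "p \<notin> orth L' N' M'"
      "\<And>A. A \<in> orth L' (Suc N') M' \<Longrightarrow> \<exists>c. A - Polynomial.smult c p \<in> orth L' N' M'"
      using L'.orth_Suc[OF step.hyps(1)] by blast
    have new: "curve_class \<phi> [:0, p:] \<notin> orth_classes \<phi> L L' N M N' M'"
      using p(2) by (auto simp: orth_classes_def dest!: normal_form_unique)
    have "R.line_extension (scalars \<phi>) (curve_class \<phi> [:0, p:]) (orth_classes \<phi> L L' N M N' M')
        = orth_classes \<phi> L L' N M (Suc N') M'" (is "?E = ?F")
    proof (intro equalityI subsetI)
      fix F assume "F \<in> ?E"
      then obtain c A B where "A \<in> orth L N M" "B \<in> orth L' N' M'"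
        "F = curve_class \<phi> [:A, Polynomial.smult c p + B:]"
        by (auto simp: in_line_extension_iff orth_classes_def curve_class_add)
      then show "F \<in> ?F"
        using p(1) L'.orth_mono[of N' "Suc N'" M' M']
        by (auto simp: orth_classes_def intro!: L'.add_in_orth L'.smult_in_orth exI)
    next
      fix F assume "F \<in> ?F"
      then obtain A B where F: "A \<in> orth L N M" "B \<in> orth L' (Suc N') M'" "F = curve_class \<phi> [:A, B:]"
        by (auto simp: orth_classes_def)
      obtain c where "B - Polynomial.smult c p \<in> orth L' N' M'" using p(3)[OF F(2)] by blast
      then have "curve_class \<phi> [:A, B - Polynomial.smult c p:] \<in> orth_classes \<phi> L L' N M N' M'"
        using F(1) by (auto simp: orth_classes_def)
      then show "F \<in> ?E"
        unfolding in_line_extension_iff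
        by (intro exI[of _ c] bexI) (simp_all add: F(3) curve_class_add)
    qed
    then show ?case
      using R.Suc_dim[OF curve_class_closed new step.IH] step.hyps(1) by (simp add: Suc_diff_le)
  qed
qed

section \<open>The inner product\<close>

definition moment :: "real set \<Rightarrow> (real \<Rightarrow> real) \<Rightarrow> real poly \<Rightarrow> real" where
  "moment S w A = (LINT x | lebesgue_on S. poly A x * w x)"

lemma integrable_poly_weight:
  assumes "weight_on S w"
  shows "integrable (lebesgue_on S) (\<lambda>x. poly A x * w x)"
proof -
  have [measurable]: "w \<in> borel_measurable (lebesgue_on S)"
    using assms by (simp add: weight_on_def)
  have [measurable]: "(\<lambda>x::real. x) \<in> borel_measurable (lebesgue_on S)"
    by (intro measurable_restrict_space1 measurable_completion) simp
  have "integrable (lebesgue_on S) (\<lambda>x. x ^ k * w x)" for k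
  proof (rule Bochner_Integration.integrable_bound)
    show "integrable (lebesgue_on S) (\<lambda>x. \<bar>x\<bar> ^ k * w x)"
      using assms by (simp add: weight_on_def)
  qed (simp_all add: abs_mult power_abs)
  then have "integrable (lebesgue_on S)
      (\<lambda>x. \<Sum>i\<le>Polynomial.degree A. Polynomial.coeff A i * (x ^ i * w x))"
    by (intro Bochner_Integration.integrable_sum integrable_mult_right)
  then show ?thesis
    by (simp add: poly_altdef sum_distrib_right mult.assoc)
qed

lemma moment_add: "weight_on S w \<Longrightarrow> moment S w (A + B) = moment S w A + moment S w B"
  by (simp add: moment_def distrib_right integrable_poly_weight Bochner_Integration.integral_add)

lemma moment_smult: "moment S w (Polynomial.smult c A) = c * moment S w A"
  by (simp add: moment_def mult.assoc)

text \<open>If a nonnegative integrand has integral 0, it vanishes almost everywhere; since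
  \<open>A\<close> has finitely many roots, \<open>w\<close> would then vanish almost everywhere,
  which a weight does not.\<close>

lemma moment_pos:
  assumes "weight_on S w" "S \<in> sets lebesgue" "A \<noteq> 0" "\<And>x. x \<in> S \<Longrightarrow> 0 \<le> poly A x"
  shows "0 < moment S w A"
proof -
  have nonneg: "AE x in lebesgue_on S. 0 \<le> poly A x * w x"
    using assms(1,4) by (intro AE_I2) (auto simp: weight_on_def)
  have "moment S w A \<noteq> 0"
  proof
    assume "moment S w A = 0"
    then have zero: "AE x in lebesgue_on S. poly A x * w x = 0"
      using integral_nonneg_eq_0_iff_AE[OF integrable_poly_weight[OF assms(1)] nonneg]
      by (simp add: moment_def)
    have "{x. poly A x = 0} \<in> null_sets lebesgue"
      using poly_roots_finite[OF assms(3)] by (intro null_sets_completionI finite_imp_null_set_lborel)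
    then have "AE x in lebesgue. poly A x \<noteq> 0"
      by (auto dest: AE_not_in)
    then have "AE x in lebesgue_on S. poly A x \<noteq> 0"
      using assms(2) by (auto simp: AE_restrict_space_iff elim: eventually_mono)
    with zero have "AE x in lebesgue_on S. w x = 0"
      by eventually_elim simp
    then show False using assms(1) by (simp add: weight_on_def)
  qed
  moreover have "0 \<le> moment S w A"
    unfolding moment_def by (rule integral_nonneg_AE[OF nonneg])
  ultimately show ?thesis by simp
qed

lemma Omega_lebesgue: "Omega \<phi> \<in> sets lebesgue"
  unfolding Omega_def
  by (rule sets_completionI_sets) (simp add: borel_open open_Collect_less continuous_intros)

text \<open>Used with \<open>B = 1\<close> for the even parts and \<open>B = \<phi>\<close>,
  positive on \<open>Omega \<phi>\<close>, for the odd parts.\<close>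

lemma positive_functional_moment:
  assumes "weight_on (Omega \<phi>) w" "B \<noteq> 0" "\<And>x. x \<in> Omega \<phi> \<Longrightarrow> 0 \<le> poly B x"
  shows "positive_functional (\<lambda>A. moment (Omega \<phi>) w (B * A))"
proof
  show "moment (Omega \<phi>) w (B * (A * A)) > 0" if "A \<noteq> 0" for A
    using that assms by (intro moment_pos Omega_lebesgue) simp_all
qed (simp_all add: distrib_left moment_add assms(1) moment_smult)

text \<open>Summing over the two points \<open>y = s\<close> and \<open>y = -s\<close> above
  \<open>x\<close> cancels the cross terms, which are odd in \<open>s\<close>, and
  \<open>s^2 = \<phi>(x)\<close>.\<close>

lemma curve_inner_normal_form:
  assumes "weight_on (Omega \<phi>) w"
  shows "curve_inner \<phi> w (curve_class \<phi> [:A, B:]) (curve_class \<phi> [:C, D:])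
    = 2 * moment (Omega \<phi>) w (1 * (A * C)) + 2 * moment (Omega \<phi>) w (\<phi> * (B * D))"
proof -
  have "curve_inner \<phi> w (curve_class \<phi> [:A, B:]) (curve_class \<phi> [:C, D:])
      = moment (Omega \<phi>) w (Polynomial.smult 2 (A * C) + Polynomial.smult 2 (\<phi> * (B * D)))"
    unfolding curve_inner_def moment_def
  proof (rule Bochner_Integration.integral_cong[OF refl])
    fix x assume "x \<in> space (lebesgue_on (Omega \<phi>))"
    then have phi: "0 < poly \<phi> x" by (simp add: Omega_def)
    then have s: "sqrt (poly \<phi> x) * sqrt (poly \<phi> x) = poly \<phi> x"
      and on: "(x, sqrt (poly \<phi> x)) \<in> curve \<phi>" "(x, - sqrt (poly \<phi> x)) \<in> curve \<phi>"
      by (simp_all add: curve_def)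
    have "(poly A x + s * poly B x) * (poly C x + s * poly D x)
        + (poly A x - s * poly B x) * (poly C x - s * poly D x)
        = 2 * (poly A x * poly C x) + 2 * ((s * s) * (poly B x * poly D x))" for s
      by (simp add: algebra_simps)
    from this[of "sqrt (poly \<phi> x)"]
    show "(eval_class (curve_class \<phi> [:A, B:]) x (sqrt (poly \<phi> x)) *
           eval_class (curve_class \<phi> [:C, D:]) x (sqrt (poly \<phi> x)) +
           eval_class (curve_class \<phi> [:A, B:]) x (- sqrt (poly \<phi> x)) *
           eval_class (curve_class \<phi> [:C, D:]) x (- sqrt (poly \<phi> x))) * w x
        = poly (Polynomial.smult 2 (A * C) + Polynomial.smult 2 (\<phi> * (B * D))) x * w x"
      by (simp add: eval_class_curve_class[OF on(1)] eval_class_curve_class[OF on(2)] eval2_def s abs_of_pos[OF phi])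
  qed
  then show ?thesis by (simp add: moment_add[OF assms] moment_smult)
qed

section \<open>Splitting the orthogonality conditions and counting dimensions\<close>

text \<open>The factor 1 makes both functionals instances of \<open>positive_functional_moment\<close>.\<close>

lemma V_space_eq:
  assumes "Polynomial.degree \<phi> = 3" "weight_on (Omega \<phi>) w"
  defines "d \<equiv> \<lambda>m::int. nat (m div 2 + 1)"
  shows "V_space \<phi> w n = orth_classes \<phi> (\<lambda>A. moment (Omega \<phi>) w (1 * A)) (\<lambda>A. moment (Omega \<phi>) w (\<phi> * A))
    (d (3 * int n)) (d (3 * int n - 3)) (d (3 * int n - 3)) (d (3 * int n - 6))"
proof -
  let ?L = "moment (Omega \<phi>) w"
  have L0: "?L 0 = 0" using moment_smult[of _ _ 0 0] by simp
  \<comment> \<open>The test classes \<open>C + y D\<close> from degree n - 1 have independent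
    parts, so \<open>D = 0\<close> and \<open>C = 0\<close> isolate the two conditions; their bounds
    are 3(n - 1) and 3(n - 1) - 3.\<close>
  have decouple: "(\<forall>Q\<in>Pi_space \<phi> (int n - 1). curve_inner \<phi> w (curve_class \<phi> [:A, B:]) Q = 0) \<longleftrightarrow>
      (\<forall>C. deg2_le C (3 * int n - 3) \<longrightarrow> ?L (1 * (A * C)) = 0) \<and>
      (\<forall>D. deg2_le D (3 * int n - 6) \<longrightarrow> ?L (\<phi> * (B * D)) = 0)" for A B
  proof -
    have "(\<forall>Q\<in>Pi_space \<phi> (int n - 1). curve_inner \<phi> w (curve_class \<phi> [:A, B:]) Q = 0) \<longleftrightarrow>
      (\<forall>C D. deg2_le C (3 * int n - 3) \<and> deg2_le D (3 * int n - 6) \<longrightarrow>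
        2 * ?L (1 * (A * C)) + 2 * ?L (\<phi> * (B * D)) = 0)"
      unfolding Pi_space_eq[OF assms(1)] curve_inner_normal_form[OF assms(2), symmetric]
      by (auto simp: right_diff_distrib)
    also have "\<dots> \<longleftrightarrow> (\<forall>C. deg2_le C (3 * int n - 3) \<longrightarrow> ?L (1 * (A * C)) = 0) \<and>
      (\<forall>D. deg2_le D (3 * int n - 6) \<longrightarrow> ?L (\<phi> * (B * D)) = 0)" (is "?l \<longleftrightarrow> ?r")
    proof
      assume l: ?l
      show ?r
      proof (intro conjI allI impI)
        show "?L (1 * (A * C)) = 0" if "deg2_le C (3 * int n - 3)" for C
          using l[rule_format, of C 0] that L0 by simp
        show "?L (\<phi> * (B * D)) = 0" if "deg2_le D (3 * int n - 6)" for D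
          using l[rule_format, of 0 D] that L0 by simp
      qed
    qed simp
    finally show ?thesis .
  qed
  have "V_space \<phi> w n = {curve_class \<phi> [:A, B:] | A B.
      (deg2_le A (3 * int n) \<and> deg2_le B (3 * int n - 3)) \<and>
      (\<forall>Q\<in>Pi_space \<phi> (int n - 1). curve_inner \<phi> w (curve_class \<phi> [:A, B:]) Q = 0)}"
    unfolding V_space_def Pi_space_eq[OF assms(1), of "int n"] by blast
  then show ?thesis
    unfolding decouple orth_classes_def orth_def mem_Collect_eq d_def deg2_le_iff_deg_lt
    by (simp only: conj_ac)
qed

theorem proposition2p1:
  fixes a0 a1 a2 a3 :: real and \<phi> :: "real poly" and w :: "real \<Rightarrow> real"
  assumes "\<phi> = [:a3, a2, a1, a0:]"
    and "a0 > 0"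
    and "weight_on (Omega \<phi>) w"
  shows "ring.dimension (curve_ring \<phi>) 1 (scalars \<phi>) (V_space \<phi> w 0) \<and>
    ring.dimension (curve_ring \<phi>) 2 (scalars \<phi>) (V_space \<phi> w 1) \<and>
    (\<forall>n\<ge>2. ring.dimension (curve_ring \<phi>) 3 (scalars \<phi>) (V_space \<phi> w n))"
proof -
  have deg: "Polynomial.degree \<phi> = 3" and "\<phi> \<noteq> 0"
    using assms(1,2) by simp_all
  define d where "d m = nat (m div 2 + 1)" for m :: int
  have one: "positive_functional (\<lambda>A. moment (Omega \<phi>) w (1 * A))"
    by (rule positive_functional_moment[OF assms(3)]) simp_all
  have phi: "positive_functional (\<lambda>A. moment (Omega \<phi>) w (\<phi> * A))"
    by (rule positive_functional_moment[OF assms(3) \<open>\<phi> \<noteq> 0\<close>]) (simp add: Omega_def)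
  have mono: "d k \<le> d m" if "k \<le> m" for k m
    using that unfolding d_def by (intro nat_mono add_right_mono zdiv_mono1) simp_all
  \<comment> \<open>The even range has length \<open>d (3n) - d (3n - 3)\<close> and the odd one
    \<open>d (3n - 3) - d (3n - 6)\<close>; monotonicity of \<open>d\<close> makes their sum
    telescope in the naturals.\<close>
  have dim: "ring.dimension (curve_ring \<phi>) (d (3 * int n) - d (3 * int n - 6)) (scalars \<phi>) (V_space \<phi> w n)"
    for n
  proof -
    have "d (3 * int n - 6) \<le> d (3 * int n - 3)" "d (3 * int n - 3) \<le> d (3 * int n)"
      by (intro mono; simp)+
    with dimension_orth_classes[OF one phi this(2) this(1), of \<phi>] show ?thesis
      by (simp add: V_space_eq[OF deg assms(3)] d_def)
  qed
  \<comment> \<open>For \<open>n \<ge> 2\<close> the lower argument is nonnegative, so nothing is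
    truncated and lowering the argument by 6 lowers the count by exactly 3.\<close>
  have "d (3 * int n) - d (3 * int n - 6) = 3" if "n \<ge> 2" for n
  proof -
    have "3 * int n div 2 = (3 * int n - 6) div 2 + 3" by presburger
    moreover have "(3 * int n - 6) div 2 \<ge> 0" using that by simp
    ultimately show ?thesis by (simp add: d_def)
  qed
  then have "\<forall>n\<ge>2. ring.dimension (curve_ring \<phi>) 3 (scalars \<phi>) (V_space \<phi> w n)"
    using dim by metis
  \<comment> \<open>For n = 0 and n = 1 the subtracted term is \<open>d (-6)\<close> or
    \<open>d (-3)\<close>, truncated to 0, which leaves \<open>d 0 = 1\<close> and
    \<open>d 3 = 2\<close>.\<close>
  then show ?thesis
    using dim[of 0] dim[of 1] by (simp add: d_def)
qed

end
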